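(* Let $\mathcal R$ be a commutative ELT ring and let $A,B\in(\overline{\mathcal R})^{n\times n}$. If $s(\det(AB))\neq 0$, then $$\det(AB)=\det(A)\cdot\det(B).$$
   Context: Let $F$ be a totally ordered abelian group (written additively) and $L$ a commutative ring with unit. The commutative ELT ring $\mathcal R=\mathscr R(L,F)$ is the set of symbols ${}^{[\ell]}a$ ($a\in F$, $\ell\in L$) with multiplication ${}^{[\ell_1]}a_1\cdot{}^{[\ell_2]}a_2={}^{[\ell_1\ell_2]}(a_1+a_2)$ and addition ${}^{[\ell_1]}a_1+{}^{[\ell_2]}a_2$ equal to ${}^{[\ell_1]}a_1$ if $a_1>a_2$, to ${}^{[\ell_2]}a_2$ if $a_1<a_2$, and to ${}^{[\ell_1+\ell_2]}a_1$ if $a_1=a_2$. The layer of ${}^{[\ell]}a$ is $s({}^{[\ell]}a)=\ell$. Set $\overline{\mathcal R}=\mathcal R\cup\{-\infty\}$, where $-\infty+\alpha=\alpha+(-\infty)=\alpha$, $-\infty\cdot\alpha=\alpha\cdot(-\infty)=-\infty$ and $s(-\infty)=0$; this is a commutative semiring with zero $-\infty$ and unit ${}^{[1]}0$. Matrices over $\overline{\mathcal R}$ are multiplied as usual, and $\det(A)=\sum_{\sigma\in S_n}{}^{[\operatorname{sgn}\sigma]}0\cdot a_{1,\sigma(1)}\cdots a_{n,\sigma(n)}$. *)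

theory Defs
  imports "Jordan_Normal_Form.Matrix" "HOL-Combinatorics.Permutations"
begin

text \<open>
  The ELT ring with \<open>-\<infinity>\<close> adjoined, over layers \<open>'l\<close> and values \<open>'f\<close>:
  \<open>Elt l a\<close> is the symbol \<open>a\<close> with layer \<open>l\<close> (layer first), and \<open>MInf\<close> is \<open>-\<infinity>\<close>.
  Note that \<open>Elt 0 a\<close> is an element of the ELT ring itself, different from \<open>MInf\<close>.
\<close>

datatype ('l, 'f) elt = MInf | Elt 'l 'f

fun layer :: "('l::zero, 'f) elt \<Rightarrow> 'l" where
  "layer MInf = 0"
| "layer (Elt l a) = l"

instantiation elt :: (comm_ring_1, linordered_ab_group_add) comm_semiring_1
begin

definition zero_elt :: "('a, 'b) elt" where
  "zero_elt = MInf"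

definition one_elt :: "('a, 'b) elt" where
  "one_elt = Elt 1 0"

fun plus_elt :: "('a, 'b) elt \<Rightarrow> ('a, 'b) elt \<Rightarrow> ('a, 'b) elt" where
  "plus_elt MInf y = y"
| "plus_elt (Elt l a) MInf = Elt l a"
| "plus_elt (Elt l1 a1) (Elt l2 a2) =
    (if a1 > a2 then Elt l1 a1 else if a1 < a2 then Elt l2 a2 else Elt (l1 + l2) a1)"

fun times_elt :: "('a, 'b) elt \<Rightarrow> ('a, 'b) elt \<Rightarrow> ('a, 'b) elt" where
  "times_elt MInf y = MInf"
| "times_elt (Elt l a) MInf = MInf"
| "times_elt (Elt l1 a1) (Elt l2 a2) = Elt (l1 * l2) (a1 + a2)"

instance
proof
  fix x y z :: "('a, 'b) elt"
  show "x + y + z = x + (y + z)"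
    by (cases x; cases y; cases z) (auto simp: add.assoc)
  show "x + y = y + x"
    by (cases x; cases y) (auto simp: add.commute)
  show "0 + x = x"
    by (simp add: zero_elt_def)
  show "x * y * z = x * (y * z)"
    by (cases x; cases y; cases z) (auto simp: ac_simps)
  show "x * y = y * x"
    by (cases x; cases y) (auto simp: ac_simps)
  show "1 * x = x"
    by (cases x) (auto simp: one_elt_def)
  show "(x + y) * z = x * z + y * z"
    by (cases x; cases y; cases z) (auto simp: distrib_right)
  show "0 * x = 0"
    by (simp add: zero_elt_def)
  show "x * 0 = 0"
    by (cases x) (auto simp: zero_elt_def)
  show "(0 :: ('a, 'b) elt) \<noteq> 1"
    by (simp add: zero_elt_def one_elt_def)
qed

end

text \<open>
  The library determinants need a ring of entries, whereas \<open>('l, 'f) elt\<close> has no additive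
  inverses: the sign of a permutation enters as the layer of a unit of value \<open>0\<close>.
  Rows and columns are indexed from \<open>0\<close>; the definition is meant for square matrices.
\<close>

definition elt_det :: "('l::comm_ring_1, 'f::linordered_ab_group_add) elt mat \<Rightarrow> ('l, 'f) elt" where
  "elt_det A =
    (\<Sum>p | p permutes {0..<dim_row A}.
      Elt (of_int (sign p)) 0 * (\<Prod>i = 0..<dim_row A. A $$ (i, p i)))"

end

theory Submission
  imports Defs "HOL-Library.FuncSet"
begin

text \<open>
  Expanding the product of sums in \<open>det (A B)\<close> gives one summand for every map \<open>g\<close> from rows to
  rows: the product of the entries \<open>a\<^sub>i\<^sub>,\<^sub>g\<^sub>(\<^sub>i\<^sub>)\<close> times the determinant of the matrix whose row \<open>i\<close> is
  row \<open>g i\<close> of \<open>B\<close>. As over a ring, the permutations \<open>g\<close> together contribute \<open>det A \<cdot> det B\<close>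
  (lemma \<open>elt_det_permute_rows\<close>). If \<open>g\<close> is not injective, two rows agree; the terms
  of the determinant then come in pairs \<open>t\<close> and \<open>-t\<close>. Over the ELT ring such a pair does not vanish,
  but it adds up to an element of layer \<open>0\<close> (lemma \<open>layer_elt_det_equal_rows\<close>).

  Elements of layer \<open>0\<close> are closed under sums and under multiplication by arbitrary
  elements. So \<open>det (A B) = det A \<cdot> det B + G\<close> with \<open>G\<close> of layer \<open>0\<close>. Adding \<open>G\<close> to an element \<open>x\<close>
  gives \<open>x\<close> again unless \<open>G\<close> strictly dominates \<open>x\<close>, and in that case the sum is \<open>G\<close>, which has
  layer \<open>0\<close>. A nonzero layer of \<open>det (A B)\<close> therefore forces the equality.
\<close>

section \<open>Elements of layer zero\<close>

lemma layer_mult: "layer (x * y) = layer x * layer y"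
  by (cases x; cases y) auto

lemma layer_add_eq_0:
  "layer x = 0 \<Longrightarrow> layer y = 0 \<Longrightarrow> layer (x + y) = 0"
  by (cases x; cases y) auto

lemma layer_sum_eq_0:
  assumes "\<And>x. x \<in> X \<Longrightarrow> layer (f x) = 0"
  shows "layer (sum f X) = 0"
  using assms
  by (induction X rule: infinite_finite_induct) (auto simp: zero_elt_def intro: layer_add_eq_0)

text \<open>
  When the values agree, the layers add and the zero layer changes nothing; when they differ,
  the sum is the summand of larger value (\<open>-\<infinity>\<close> lying below all values), and this cannot be \<open>y\<close>
  because of its layer.
\<close>

lemma add_layer_0_absorb:
  assumes "layer y = 0" and "layer (x + y) \<noteq> 0"
  shows "x + y = x"
  using assms by (cases x; cases y) (auto split: if_splits)

section \<open>Signs and determinants\<close>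

abbreviation sign_elt :: "(nat \<Rightarrow> nat) \<Rightarrow> ('l::comm_ring_1, 'f::linordered_ab_group_add) elt" where
  "sign_elt p \<equiv> Elt (of_int (sign p)) 0"

lemma sign_elt_compose:
  assumes "p permutes {0..<n}" and "q permutes {0..<n}"
  shows "sign_elt (p \<circ> q) = sign_elt p * sign_elt q"
  using assms[THEN permutes_imp_permutation[OF finite_atLeastLessThan]]
  by (simp add: sign_compose)

lemma permutes_less:
  fixes n :: nat
  shows "p permutes {0..<n} \<Longrightarrow> i < n \<Longrightarrow> p i < n"
  using permutes_in_image[of p "{0..<n}" i] by simp

text \<open>
  Reindexing the permutations by \<open>p \<mapsto> p \<circ> q\<close> turns each product of entries into one of \<open>B\<close>.
  Signs are only multiplied here, never cancelled, so the ring proof works over the semiring and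
  gives an exact equality, without an error term of layer \<open>0\<close>.
\<close>

lemma elt_det_permute_rows:
  fixes B :: "('l::comm_ring_1, 'f::linordered_ab_group_add) elt mat"
  assumes B: "B \<in> carrier_mat n n" and q: "q permutes {0..<n}"
  shows "elt_det (mat n n (\<lambda>(i, j). B $$ (q i, j))) = sign_elt q * elt_det B"
proof -
  let ?P = "{p. p permutes {0..<n}}"
  have "elt_det (mat n n (\<lambda>(i, j). B $$ (q i, j)))
      = (\<Sum>p\<in>?P. sign_elt p * (\<Prod>i = 0..<n. B $$ (q i, p i)))"
    unfolding elt_det_def
    by (auto intro!: sum.cong arg_cong2[where f = times] prod.cong dest: permutes_less)
  also have "\<dots> = (\<Sum>p\<in>?P. sign_elt (p \<circ> q) * (\<Prod>i = 0..<n. B $$ (q i, (p \<circ> q) i)))"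
    by (rule sum_permutations_compose_right[OF q])
  also have "\<dots> = (\<Sum>p\<in>?P. sign_elt q * (sign_elt p * (\<Prod>i = 0..<n. B $$ (i, p i))))"
  proof (rule sum.cong[OF refl])
    fix p assume "p \<in> ?P"
    then have p: "p permutes {0..<n}" by simp
    have "(\<Prod>i = 0..<n. B $$ (q i, (p \<circ> q) i)) = (\<Prod>i = 0..<n. B $$ (i, p i))"
      using prod.permute[OF q, of "\<lambda>i. B $$ (i, p i)"] by (simp add: o_def)
    then show "sign_elt (p \<circ> q) * (\<Prod>i = 0..<n. B $$ (q i, (p \<circ> q) i))
        = sign_elt q * (sign_elt p * (\<Prod>i = 0..<n. B $$ (i, p i)))"
      by (simp only: sign_elt_compose[OF p q] ac_simps)
  qed
  also have "\<dots> = sign_elt q * elt_det B"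
    using B by (simp add: elt_det_def sum_distrib_left)
  finally show ?thesis .
qed

text \<open>
  Composing with the transposition \<open>\<tau>\<close> of the two equal rows exchanges even and odd permutations
  and keeps the product of entries. The sum over even \<open>p\<close> of the terms of \<open>p\<close>
  and \<open>p \<circ> \<tau>\<close> thus consists of summands \<open>(1 + -1) \<cdot> t\<close>, where \<open>1 + -1\<close> is not the zero \<open>-\<infinity>\<close>
  of the semiring but the element of value \<open>0\<close> and layer \<open>0\<close>.
\<close>

lemma layer_elt_det_equal_rows:
  fixes C :: "('l::comm_ring_1, 'f::linordered_ab_group_add) elt mat"
  assumes C: "C \<in> carrier_mat n n" and ij: "i < n" "j < n" "i \<noteq> j"
    and eq: "\<And>k. k < n \<Longrightarrow> C $$ (i, k) = C $$ (j, k)"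
  shows "layer (elt_det C) = 0"
proof -
  let ?P = "{p. p permutes {0..<n}}"
  let ?E = "{p \<in> ?P. evenperm p}" and ?O = "{p \<in> ?P. \<not> evenperm p}"
  define \<tau> where "\<tau> = transpose i j"
  define m where "m p = (\<Prod>r = 0..<n. C $$ (r, p r))" for p
  have \<tau>: "\<tau> permutes {0..<n}"
    using ij by (simp add: \<tau>_def permutes_swap_id)
  have perm: "permutation p" if "p permutes {0..<n}" for p
    using that permutation_permutes by blast
  have odd: "\<not> evenperm \<tau>"
    using ij by (simp add: \<tau>_def evenperm_swap)
  have parity: "evenperm (p \<circ> \<tau>) \<longleftrightarrow> \<not> evenperm p" if "p permutes {0..<n}" for p
    using evenperm_comp[OF perm[OF that] perm[OF \<tau>]] odd by simp
  have \<tau>\<tau>: "p \<circ> \<tau> \<circ> \<tau> = p" for p :: "nat \<Rightarrow> nat"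
    by (simp add: \<tau>_def o_assoc [symmetric])
  have bij: "bij_betw (\<lambda>p. p \<circ> \<tau>) ?E ?O"
    by (rule bij_betw_byWitness[where f' = "\<lambda>p. p \<circ> \<tau>"])
      (auto simp: \<tau>\<tau> parity intro: permutes_compose[OF \<tau>])
  have m: "m (p \<circ> \<tau>) = m p" if p: "p permutes {0..<n}" for p
  proof -
    have row: "C $$ (\<tau> r, k) = C $$ (r, k)" if "k < n" for r k
      using eq[OF that] by (auto simp: \<tau>_def transpose_def)
    have "m p = (\<Prod>r = 0..<n. C $$ (\<tau> r, p (\<tau> r)))"
      unfolding m_def using prod.permute[OF \<tau>, of "\<lambda>r. C $$ (r, p r)"] by (simp add: o_def)
    also have "\<dots> = m (p \<circ> \<tau>)"
      unfolding m_def
    proof (rule prod.cong[OF refl])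
      fix r assume "r \<in> {0..<n}"
      then have "p (\<tau> r) < n"
        using permutes_in_image[OF p, of "\<tau> r"] permutes_in_image[OF \<tau>, of r] by simp
      then show "C $$ (\<tau> r, p (\<tau> r)) = C $$ (r, (p \<circ> \<tau>) r)"
        by (simp add: row)
    qed
    finally show ?thesis ..
  qed
  have fin: "finite ?P" by (simp add: finite_permutations)
  have "elt_det C = (\<Sum>p\<in>?P. sign_elt p * m p)"
    using C by (simp add: elt_det_def m_def)
  also have "\<dots> = (\<Sum>p\<in>?E. sign_elt p * m p) + (\<Sum>p\<in>?O. sign_elt p * m p)"
    using fin by (subst sum.union_disjoint[symmetric]) (auto intro!: sum.cong)
  also have "(\<Sum>p\<in>?O. sign_elt p * m p) = (\<Sum>p\<in>?E. sign_elt (p \<circ> \<tau>) * m (p \<circ> \<tau>))"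
    by (rule sum.reindex_bij_betw[OF bij, symmetric])
  also have "(\<Sum>p\<in>?E. sign_elt p * m p) + \<dots>
      = (\<Sum>p\<in>?E. (sign_elt p + sign_elt (p \<circ> \<tau>)) * m p)"
    unfolding sum.distrib[symmetric] by (rule sum.cong[OF refl]) (simp only: mem_Collect_eq m distrib_right)
  also have "layer \<dots> = 0"
    by (rule layer_sum_eq_0) (simp add: layer_mult sign_def parity)
  finally show ?thesis .
qed

section \<open>Expansion of the determinant of a product\<close>

lemma elt_det_mult_expand:
  fixes A B :: "('l::comm_ring_1, 'f::linordered_ab_group_add) elt mat"
  assumes A: "A \<in> carrier_mat n n" and B: "B \<in> carrier_mat n n"
  shows "elt_det (A * B) = (\<Sum>g \<in> {0..<n} \<rightarrow>\<^sub>E {0..<n}.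
    (\<Prod>i = 0..<n. A $$ (i, g i)) * elt_det (mat n n (\<lambda>(i, j). B $$ (g i, j))))"
proof -
  let ?P = "{p. p permutes {0..<n}}" and ?F = "{0..<n} \<rightarrow>\<^sub>E {0..<n}"
  have "elt_det (A * B)
      = (\<Sum>p\<in>?P. sign_elt p * (\<Prod>i = 0..<n. \<Sum>k = 0..<n. A $$ (i, k) * B $$ (k, p i)))"
    using A B unfolding elt_det_def
    by (auto intro!: sum.cong arg_cong2[where f = times] prod.cong
        simp: scalar_prod_def dest: permutes_less)
  also have "\<dots> = (\<Sum>p\<in>?P. \<Sum>g\<in>?F.
      sign_elt p * ((\<Prod>i = 0..<n. A $$ (i, g i)) * (\<Prod>i = 0..<n. B $$ (g i, p i))))"
    by (simp add: prod_sum_PiE sum_distrib_left prod.distrib)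
  also have "\<dots> = (\<Sum>g\<in>?F. \<Sum>p\<in>?P.
      (\<Prod>i = 0..<n. A $$ (i, g i)) * (sign_elt p * (\<Prod>i = 0..<n. B $$ (g i, p i))))"
    by (subst sum.swap) (simp only: ac_simps)
  also have "\<dots> = (\<Sum>g\<in>?F. (\<Prod>i = 0..<n. A $$ (i, g i)) *
      elt_det (mat n n (\<lambda>(i, j). B $$ (g i, j))))"
    unfolding elt_det_def sum_distrib_left
    by (auto intro!: sum.cong arg_cong2[where f = times] prod.cong
        dest: permutes_less)
  finally show ?thesis .
qed

text \<open>
  A permutation is the identity outside the index set, whereas an element of \<open>S \<rightarrow>\<^sub>E S\<close> is
  \<open>undefined\<close> there; \<open>restrict\<close> passes from the one to the other.
\<close>

lemma bij_betw_restrict_permutes: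
  assumes "finite S"
  shows "bij_betw (\<lambda>p. restrict p S) {p. p permutes S} {g \<in> S \<rightarrow>\<^sub>E S. inj_on g S}"
proof (rule bij_betw_byWitness[where f' = "\<lambda>g x. if x \<in> S then g x else x"])
  show "\<forall>p\<in>{p. p permutes S}. (\<lambda>x. if x \<in> S then restrict p S x else x) = p"
    by (auto simp: fun_eq_iff permutes_not_in)
  show "\<forall>g\<in>{g \<in> S \<rightarrow>\<^sub>E S. inj_on g S}. (\<lambda>x\<in>S. if x \<in> S then g x else x) = g"
    by (auto cong: restrict_cong intro: PiE_restrict)
  show "(\<lambda>p. restrict p S) ` {p. p permutes S} \<subseteq> {g \<in> S \<rightarrow>\<^sub>E S. inj_on g S}"
    by (auto simp: permutes_in_image inj_on_restrict_eq intro: permutes_inj_on)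
  show "(\<lambda>g x. if x \<in> S then g x else x) ` {g \<in> S \<rightarrow>\<^sub>E S. inj_on g S} \<subseteq> {p. p permutes S}"
  proof clarify
    fix g assume g: "g \<in> S \<rightarrow>\<^sub>E S" "inj_on g S"
    have "bij_betw g S S"
      using g endo_inj_surj[OF assms, of g] by (auto simp: bij_betw_def)
    then have "bij_betw (\<lambda>x. if x \<in> S then g x else x) S S"
      by (rule bij_betw_cong[THEN iffD1, rotated]) simp
    then show "(\<lambda>x. if x \<in> S then g x else x) permutes S"
      by (rule bij_imp_permutes) simp
  qed
qed

theorem corollary2p16:
  fixes A B :: "('l::comm_ring_1, 'f::linordered_ab_group_add) elt mat"
    and n :: nat
  assumes "A \<in> carrier_mat n n" and "B \<in> carrier_mat n n"
    and "layer (elt_det (A * B)) \<noteq> 0"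
  shows "elt_det (A * B) = elt_det A * elt_det B"
proof -
  note A = assms(1) and B = assms(2)
  let ?S = "{0..<n}"
  let ?P = "{p. p permutes ?S}" and ?F = "?S \<rightarrow>\<^sub>E ?S"
  let ?I = "{g \<in> ?F. inj_on g ?S}" and ?N = "{g \<in> ?F. \<not> inj_on g ?S}"
  define t where "t g =
    (\<Prod>i = 0..<n. A $$ (i, g i)) * elt_det (mat n n (\<lambda>(i, j). B $$ (g i, j)))" for g
  have fin: "finite ?F" by (simp add: finite_PiE)
  have "elt_det (A * B) = (\<Sum>g\<in>?F. t g)"
    unfolding t_def by (rule elt_det_mult_expand[OF A B])
  also have "\<dots> = (\<Sum>g\<in>?I. t g) + (\<Sum>g\<in>?N. t g)"
    using fin by (subst sum.union_disjoint[symmetric]) (auto intro!: sum.cong)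
  also have "(\<Sum>g\<in>?I. t g) = (\<Sum>p\<in>?P. t (restrict p ?S))"
    by (rule sum.reindex_bij_betw[OF bij_betw_restrict_permutes, symmetric]) simp
  also have "\<dots> = (\<Sum>p\<in>?P. sign_elt p * (\<Prod>i = 0..<n. A $$ (i, p i)) * elt_det B)"
  proof (rule sum.cong[OF refl])
    fix p assume "p \<in> ?P"
    then have p: "p permutes ?S" by simp
    have "mat n n (\<lambda>(i, j). B $$ (restrict p ?S i, j)) = mat n n (\<lambda>(i, j). B $$ (p i, j))"
      by (rule eq_matI) auto
    then have "t (restrict p ?S) = (\<Prod>i = 0..<n. A $$ (i, p i)) * (sign_elt p * elt_det B)"
      by (simp add: t_def elt_det_permute_rows[OF B p])
    then show "t (restrict p ?S) = sign_elt p * (\<Prod>i = 0..<n. A $$ (i, p i)) * elt_det B"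
      by (simp only: ac_simps)
  qed
  also have "\<dots> = elt_det A * elt_det B"
    using A by (simp add: elt_det_def sum_distrib_right)
  finally have split: "elt_det (A * B) = elt_det A * elt_det B + (\<Sum>g\<in>?N. t g)" .
  have "layer (\<Sum>g\<in>?N. t g) = 0"
  proof (rule layer_sum_eq_0)
    fix g assume "g \<in> ?N"
    then obtain i j where "i < n" "j < n" "i \<noteq> j" "g i = g j"
      by (auto simp: inj_on_def)
    then have "layer (elt_det (mat n n (\<lambda>(i, j). B $$ (g i, j)))) = 0"
      by (intro layer_elt_det_equal_rows[of _ n i j]) auto
    then show "layer (t g) = 0"
      by (simp add: t_def layer_mult)
  qed
  then show ?thesis
    using add_layer_0_absorb assms(3) unfolding split by blast
qed

end
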